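(* Let $(\mathcal X,d)$ be a proper Hadamard space, $\mathcal Y$ a set, $\pi:\mathcal X\to\mathcal Y$ a map, and $E:\mathcal X\to(-\infty,+\infty]$. Assume that every nonempty fiber $\mathcal F_y=\pi^{-1}(y)$ is closed and geodesically convex, that $E$ is lower semicontinuous, and that there is a common $\mu>0$ such that the restriction of $E$ to each fiber is coercive and $\mu$-strongly geodesically convex. Then for every $y\in\mathcal Y$ with $(\pi_!E)(y)$ finite there is a unique minimizer $$s_E(y)=\operatorname*{arg\,min}_{\pi(x)=y}E(x),\qquad E(s_E(y))=(\pi_!E)(y).$$ If moreover a group acts isometrically on $\mathcal X$ and acts on $\mathcal Y$, such that $E(gx)=E(x)$ and $\pi(gx)=g\,\pi(x)$ for all group elements $g$ and all $x\in\mathcal X$, then $$s_E(gy)=g\,s_E(y)$$ for all $g$ and all $y$ with $(\pi_!E)(y)$ finite.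
   Context: The infimal pushforward is $(\pi_!E)(y)=\inf_{\pi(x)=y}E(x)$, with $\inf\varnothing=+\infty$. A Hadamard space is a complete CAT(0) geodesic space; proper means that closed bounded sets are compact. A function $f$ on a geodesically convex set is $\mu$-strongly geodesically convex if for every constant-speed geodesic $\gamma:[0,1]\to$ (the set), $f(\gamma_t)\le(1-t)f(\gamma_0)+tf(\gamma_1)-\frac{\mu}{2}t(1-t)d(\gamma_0,\gamma_1)^2$ for all $t\in[0,1]$. Coercive means that sublevel sets are bounded. *)

theory Defs
  imports "HOL-Analysis.Analysis" "HOL-Algebra.Group_Action"
begin

(* Constant-speed geodesics parametrised by [0,1]; values outside [0,1] are irrelevant. *)
definition geodesic :: "(real \<Rightarrow> 'a::metric_space) \<Rightarrow> bool" where
  "geodesic \<gamma> \<longleftrightarrow>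
    (\<forall>s\<in>{0..1}. \<forall>t\<in>{0..1}. dist (\<gamma> s) (\<gamma> t) = \<bar>s - t\<bar> * dist (\<gamma> 0) (\<gamma> 1))"

(* The vertices are g i 0 for i < 3, and side i runs from vertex i to vertex (i + 1) mod 3. *)
definition geodesic_triangle :: "(nat \<Rightarrow> real \<Rightarrow> 'a::metric_space) \<Rightarrow> bool" where
  "geodesic_triangle g \<longleftrightarrow>
    (\<forall>i<3. geodesic (g i) \<and> g i 1 = g (Suc i mod 3) 0)"

definition comparison_triangle ::
    "(nat \<Rightarrow> real \<Rightarrow> 'a::metric_space) \<Rightarrow> (nat \<Rightarrow> real ^ 2) \<Rightarrow> bool" where
  "comparison_triangle g w \<longleftrightarrow>
    (\<forall>i<3. \<forall>j<3. dist (w i) (w j) = dist (g i 0) (g j 0))"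

(* The comparison point of g i s. *)
definition comparison_point :: "(nat \<Rightarrow> real ^ 2) \<Rightarrow> nat \<Rightarrow> real \<Rightarrow> real ^ 2" where
  "comparison_point w i s = (1 - s) *\<^sub>R w i + s *\<^sub>R w (Suc i mod 3)"

(* Geodesic triangles are no thicker than their Euclidean comparison triangles:
   the CAT(0) inequality for every pair of points on the triangle. *)
class hadamard_space = complete_space +
  assumes geodesic_exists: "\<exists>\<gamma>. geodesic \<gamma> \<and> \<gamma> 0 = x \<and> \<gamma> 1 = y"
    and cat0: "\<lbrakk>geodesic_triangle g; comparison_triangle g w;
                i < 3; j < 3; s \<in> {0..1}; t \<in> {0..1}\<rbrakk>
      \<Longrightarrow> dist (g i s) (g j t) \<le> dist (comparison_point w i s) (comparison_point w j t)"

definition geodesically_convex :: "'a::metric_space set \<Rightarrow> bool" where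
  "geodesically_convex S \<longleftrightarrow>
    (\<forall>\<gamma>. geodesic \<gamma> \<and> \<gamma> 0 \<in> S \<and> \<gamma> 1 \<in> S \<longrightarrow> \<gamma> ` {0..1} \<subseteq> S)"

(* The convention 0 * \<infinity> = 0 of ereal makes the inequality trivial at t = 0 and t = 1. *)
definition strongly_geodesically_convex_on ::
    "real \<Rightarrow> 'a::metric_space set \<Rightarrow> ('a \<Rightarrow> ereal) \<Rightarrow> bool" where
  "strongly_geodesically_convex_on \<mu> S f \<longleftrightarrow>
    (\<forall>\<gamma>. geodesic \<gamma> \<and> \<gamma> ` {0..1} \<subseteq> S \<longrightarrow>
      (\<forall>t\<in>{0..1}. f (\<gamma> t) \<le> ereal (1 - t) * f (\<gamma> 0) + ereal t * f (\<gamma> 1)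
          - ereal (\<mu> / 2 * t * (1 - t) * (dist (\<gamma> 0) (\<gamma> 1))\<^sup>2)))"

definition coercive_on :: "'a::metric_space set \<Rightarrow> ('a \<Rightarrow> ereal) \<Rightarrow> bool" where
  "coercive_on S f \<longleftrightarrow> (\<forall>c::real. bounded {x \<in> S. f x \<le> ereal c})"

definition lower_semicontinuous :: "('a::topological_space \<Rightarrow> ereal) \<Rightarrow> bool" where
  "lower_semicontinuous f \<longleftrightarrow> (\<forall>x. f x \<le> Liminf (at x) f)"

(* The infimum of the empty set is \<infinity> in ereal. *)
definition infimal_pushforward :: "('a \<Rightarrow> 'b) \<Rightarrow> ('a \<Rightarrow> ereal) \<Rightarrow> 'b \<Rightarrow> ereal" where
  "infimal_pushforward \<pi> E y = (INF x\<in>\<pi> -` {y}. E x)"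

(* Only meaningful where a minimiser on the fiber exists and is unique. *)
definition fiber_argmin :: "('a \<Rightarrow> 'b) \<Rightarrow> ('a \<Rightarrow> ereal) \<Rightarrow> 'b \<Rightarrow> 'a" where
  "fiber_argmin \<pi> E y = arg_min E (\<lambda>x. \<pi> x = y)"

end

theory Submission
  imports Defs
begin

text \<open>
  Existence is the direct method: on a fiber with finite infimum \<open>m\<close>, the sublevel sets of \<open>E\<close>
  at the real levels \<open>c > m\<close> are nonempty, closed because the fiber is closed and \<open>E\<close> is lower
  semicontinuous, and bounded by coercivity. In a proper space they therefore form a chain of
  nonempty compact sets, which has a common point, and such a point attains \<open>m\<close>
  (lemma \<open>coercive_attains_Inf\<close>).

  Uniqueness is strict convexity: fibers are geodesically convex, so the midpoint of a geodesic
  joining two minimizers is a competitor, and strong convexity puts its energy below \<open>m\<close> by at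
  least \<open>\<mu> / 8\<close> times the squared distance of the minimizers (lemma \<open>strongly_convex_argmin_unique\<close>).

  For the equivariance, a group element \<open>g\<close> carries the fiber over \<open>y\<close> onto the fiber over \<open>g y\<close>
  without changing \<open>E\<close>. Both fibers hence have the same infimum, \<open>g\<close> maps minimizers to minimizers,
  and uniqueness on the fiber over \<open>g y\<close> identifies the image of the minimizer
  over \<open>y\<close> with the minimizer over \<open>g y\<close>.
\<close>

lemma lower_semicontinuous_closed_sublevel:
  assumes "lower_semicontinuous f"
  shows "closed {x. f x \<le> c}"
proof -
  have "open (- {x. f x \<le> c})"
  proof (rule topological_space_class.openI)
    fix x assume x: "x \<in> - {x. f x \<le> c}"
    have "c < f x" using x by simp
    also have "f x \<le> Liminf (at x) f"
      using assms unfolding lower_semicontinuous_def by blast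
    finally have "eventually (\<lambda>z. c < f z) (at x)" by (rule less_LiminfD)
    \<comment> \<open>The punctured filter says nothing about \<open>x\<close> itself, where the bound is the hypothesis.\<close>
    then have "eventually (\<lambda>z. z \<in> - {x. f x \<le> c}) (nhds x)"
      using x unfolding eventually_at_filter by (auto elim!: eventually_mono)
    then show "\<exists>T. open T \<and> x \<in> T \<and> T \<subseteq> - {x. f x \<le> c}"
      unfolding eventually_nhds subset_eq .
  qed
  then show ?thesis by (simp add: closed_def)
qed

text \<open>
  The minimizer is a common point of all sublevel sets above the infimum. These are nested, so
  finitely many of them contain the nonempty one at their least level, and the finite intersection
  property applies inside one compact sublevel set.
\<close>

lemma coercive_attains_Inf:
  fixes E :: "'a::metric_space \<Rightarrow> ereal"
  assumes proper: "\<And>T::'a set. closed T \<Longrightarrow> bounded T \<Longrightarrow> compact T"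
    and "closed S" and lsc: "lower_semicontinuous E" and coercive: "coercive_on S E"
    and finite: "\<bar>INF x\<in>S. E x\<bar> \<noteq> \<infinity>"
  obtains x where "x \<in> S" and "E x = (INF x\<in>S. E x)"
proof -
  obtain m where m: "(INF x\<in>S. E x) = ereal m"
    using finite by (cases "INF x\<in>S. E x") auto
  define K where "K c = {x \<in> S. E x \<le> ereal c}" for c
  have closed: "closed (K c)" for c
  proof -
    have "K c = S \<inter> {x. E x \<le> ereal c}" unfolding K_def by auto
    then show ?thesis
      using \<open>closed S\<close> lower_semicontinuous_closed_sublevel[OF lsc] by auto
  qed
  have "bounded (K (m + 1))" using coercive unfolding coercive_on_def K_def by blast
  then have "compact (K (m + 1))" using proper closed by blast
  have nonempty: "K c \<noteq> {}" if "m < c" for c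
  proof -
    have "(INF x\<in>S. E x) < ereal c" using that m by simp
    then obtain x where "x \<in> S" "E x < ereal c" unfolding INF_less_iff by blast
    then have "x \<in> K c" unfolding K_def by (simp add: order_less_imp_le)
    then show ?thesis by blast
  qed
  have nested: "K c \<subseteq> K c'" if "c \<le> c'" for c c'
    using that unfolding K_def by (auto intro: order_trans)
  have "K (m + 1) \<inter> (\<Inter>c\<in>{m<..}. K c) \<noteq> {}"
  proof (rule compact_imp_fip_image[OF \<open>compact (K (m + 1))\<close> closed])
    fix I assume I: "finite I" "I \<subseteq> {m<..}"
    define c where "c = Min (insert (m + 1) I)"
    have "m < c" using I unfolding c_def by auto
    have "K c \<subseteq> K (m + 1) \<inter> (\<Inter>c\<in>I. K c)"
      using \<open>finite I\<close> by (intro Int_greatest INT_greatest nested) (auto simp: c_def)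
    with nonempty[OF \<open>m < c\<close>] show "K (m + 1) \<inter> (\<Inter>c\<in>I. K c) \<noteq> {}" by blast
  qed
  then obtain x where x: "\<And>c. m < c \<Longrightarrow> x \<in> K c" by blast
  have "x \<in> S" using x[of "m + 1"] unfolding K_def by simp
  have "E x \<le> ereal m"
  proof (rule ereal_le_epsilon2)
    fix e :: real assume "0 < e"
    then show "E x \<le> ereal m + ereal e" using x[of "m + e"] unfolding K_def by simp
  qed
  then have "E x = (INF x\<in>S. E x)"
    using m \<open>x \<in> S\<close> by (metis INF_lower antisym)
  with \<open>x \<in> S\<close> show thesis by (rule that)
qed

lemma strongly_convex_argmin_unique:
  fixes E :: "'a::hadamard_space \<Rightarrow> ereal"
  assumes "\<mu> > 0" and "geodesically_convex S" and "strongly_geodesically_convex_on \<mu> S E"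
    and "x \<in> S" "y \<in> S" and min: "\<And>z. z \<in> S \<Longrightarrow> ereal m \<le> E z"
    and "E x = ereal m" "E y = ereal m"
  shows "x = y"
proof (rule ccontr)
  assume "x \<noteq> y"
  obtain \<gamma> where \<gamma>: "geodesic \<gamma>" "\<gamma> 0 = x" "\<gamma> 1 = y" using geodesic_exists by blast
  have in_S: "\<gamma> ` {0..1} \<subseteq> S"
    using assms(2) \<gamma> \<open>x \<in> S\<close> \<open>y \<in> S\<close> unfolding geodesically_convex_def by blast
  have "\<forall>t\<in>{0..1}. E (\<gamma> t) \<le> ereal (1 - t) * E (\<gamma> 0) + ereal t * E (\<gamma> 1)
          - ereal (\<mu> / 2 * t * (1 - t) * (dist (\<gamma> 0) (\<gamma> 1))\<^sup>2)"
    using assms(3) \<gamma>(1) in_S unfolding strongly_geodesically_convex_on_def by blast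
  from bspec[OF this, of "1/2"]
  have "E (\<gamma> (1/2)) \<le> ereal (m - \<mu> / 8 * (dist x y)\<^sup>2)"
    by (simp add: \<gamma> \<open>E x = ereal m\<close> \<open>E y = ereal m\<close>)
  moreover have "ereal m \<le> E (\<gamma> (1/2))" using in_S by (intro min) auto
  ultimately have "ereal m \<le> ereal (m - \<mu> / 8 * (dist x y)\<^sup>2)" by (rule order_trans[rotated])
  moreover have "0 < \<mu> / 8 * (dist x y)\<^sup>2" using \<open>\<mu> > 0\<close> \<open>x \<noteq> y\<close> by simp
  ultimately show False by simp
qed

text \<open>Minimality as attainment of the pushforward: the form in which existence, uniqueness and
  equivariance all speak of the same number.\<close>

lemma is_arg_min_fiber_iff:
  "is_arg_min E (\<lambda>x. \<pi> x = y) x \<longleftrightarrow> \<pi> x = y \<and> E x = infimal_pushforward \<pi> E y"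
proof
  assume "is_arg_min E (\<lambda>x. \<pi> x = y) x"
  then show "\<pi> x = y \<and> E x = infimal_pushforward \<pi> E y"
    unfolding is_arg_min_linorder infimal_pushforward_def
    by (auto intro!: antisym INF_greatest INF_lower)
next
  assume "\<pi> x = y \<and> E x = infimal_pushforward \<pi> E y"
  then show "is_arg_min E (\<lambda>x. \<pi> x = y) x"
    unfolding is_arg_min_linorder infimal_pushforward_def
    by (auto intro: INF_lower)
qed

lemma vimage_equivariant:
  assumes "surj a" and "inj b" and "\<And>x. \<pi> (a x) = b (\<pi> x)"
  shows "\<pi> -` {b y} = a ` (\<pi> -` {y})"
proof (intro equalityI subsetI)
  fix x assume "x \<in> \<pi> -` {b y}"
  moreover obtain x' where "x = a x'" using \<open>surj a\<close> by blast
  ultimately show "x \<in> a ` (\<pi> -` {y})" using assms(2,3) by (auto dest: injD)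
qed (use assms(3) in auto)

lemma infimal_pushforward_equivariant:
  assumes "surj a" and "inj b" and "\<And>x. \<pi> (a x) = b (\<pi> x)" and "\<And>x. E (a x) = E x"
  shows "infimal_pushforward \<pi> E (b y) = infimal_pushforward \<pi> E y"
  unfolding infimal_pushforward_def vimage_equivariant[of a b \<pi> y, OF assms(1-3)]
  by (simp add: image_image assms(4))

theorem theorem2:
  fixes \<pi> :: "'a::hadamard_space \<Rightarrow> 'b"
    and E :: "'a \<Rightarrow> ereal"
    and \<mu> :: real
  assumes proper: "\<And>S::'a set. closed S \<Longrightarrow> bounded S \<Longrightarrow> compact S"
    and E_not_minus_infinity: "\<And>x. E x \<noteq> -\<infinity>"
    and fiber_closed: "\<And>y. \<pi> -` {y} \<noteq> {} \<Longrightarrow> closed (\<pi> -` {y})"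
    and fiber_convex: "\<And>y. \<pi> -` {y} \<noteq> {} \<Longrightarrow> geodesically_convex (\<pi> -` {y})"
    and lsc: "lower_semicontinuous E"
    and mu_pos: "\<mu> > 0"
    and coercive: "\<And>y. \<pi> -` {y} \<noteq> {} \<Longrightarrow> coercive_on (\<pi> -` {y}) E"
    and strongly_convex: "\<And>y. \<pi> -` {y} \<noteq> {} \<Longrightarrow>
      strongly_geodesically_convex_on \<mu> (\<pi> -` {y}) E"
  shows
    "(\<forall>y. \<bar>infimal_pushforward \<pi> E y\<bar> \<noteq> \<infinity> \<longrightarrow>
        (\<exists>!x. is_arg_min E (\<lambda>x. \<pi> x = y) x) \<and>
        is_arg_min E (\<lambda>x. \<pi> x = y) (fiber_argmin \<pi> E y) \<and>
        E (fiber_argmin \<pi> E y) = infimal_pushforward \<pi> E y) \<and>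
     (\<forall>(G::('g, 'm) monoid_scheme) (\<alpha>::'g \<Rightarrow> 'a \<Rightarrow> 'a) (\<beta>::'g \<Rightarrow> 'b \<Rightarrow> 'b).
        group_action G UNIV \<alpha> \<and>
        (\<forall>g\<in>carrier G. \<forall>x x'. dist (\<alpha> g x) (\<alpha> g x') = dist x x') \<and>
        group_action G UNIV \<beta> \<and>
        (\<forall>g\<in>carrier G. \<forall>x. E (\<alpha> g x) = E x \<and> \<pi> (\<alpha> g x) = \<beta> g (\<pi> x)) \<longrightarrow>
        (\<forall>g\<in>carrier G. \<forall>y. \<bar>infimal_pushforward \<pi> E y\<bar> \<noteq> \<infinity> \<longrightarrow>
           \<bar>infimal_pushforward \<pi> E (\<beta> g y)\<bar> \<noteq> \<infinity> \<and>
           fiber_argmin \<pi> E (\<beta> g y) = \<alpha> g (fiber_argmin \<pi> E y)))"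
proof -
  have unique: "\<exists>!x. is_arg_min E (\<lambda>x. \<pi> x = y) x"
    if finite: "\<bar>infimal_pushforward \<pi> E y\<bar> \<noteq> \<infinity>" for y
  proof -
    obtain m where m: "infimal_pushforward \<pi> E y = ereal m"
      using finite by (cases "infimal_pushforward \<pi> E y") auto
    \<comment> \<open>An empty fiber has infimum \<open>\<infinity>\<close>.\<close>
    have nonempty: "\<pi> -` {y} \<noteq> {}"
      using finite by (auto simp: infimal_pushforward_def top_ereal_def)
    obtain x where "x \<in> \<pi> -` {y}" "E x = infimal_pushforward \<pi> E y"
      unfolding infimal_pushforward_def
    proof (rule coercive_attains_Inf)
      show "closed (\<pi> -` {y})" "coercive_on (\<pi> -` {y}) E"
        using fiber_closed coercive nonempty by blast+
      show "\<bar>INF x\<in>\<pi> -` {y}. E x\<bar> \<noteq> \<infinity>"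
        using finite unfolding infimal_pushforward_def .
    qed (use proper lsc in auto)
    then have "is_arg_min E (\<lambda>x. \<pi> x = y) x" by (simp add: is_arg_min_fiber_iff)
    moreover have "z = x"
      if "is_arg_min E (\<lambda>x. \<pi> x = y) z" "is_arg_min E (\<lambda>x. \<pi> x = y) x" for z x
    proof (rule strongly_convex_argmin_unique
        [OF mu_pos fiber_convex[OF nonempty] strongly_convex[OF nonempty]])
      show "ereal m \<le> E w" if "w \<in> \<pi> -` {y}" for w
        using that m unfolding infimal_pushforward_def by (metis INF_lower)
    qed (use that m in \<open>simp_all add: is_arg_min_fiber_iff\<close>)
    ultimately show ?thesis by blast
  qed
  have argmin: "is_arg_min E (\<lambda>x. \<pi> x = y) (fiber_argmin \<pi> E y)"
    if "\<bar>infimal_pushforward \<pi> E y\<bar> \<noteq> \<infinity>" for y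
    using unique[OF that] unfolding fiber_argmin_def arg_min_def by (metis someI)
  have equivariant: "\<bar>infimal_pushforward \<pi> E (\<beta> g y)\<bar> \<noteq> \<infinity> \<and>
      fiber_argmin \<pi> E (\<beta> g y) = \<alpha> g (fiber_argmin \<pi> E y)"
    if "group_action G UNIV \<alpha>" "group_action G UNIV \<beta>" "g \<in> carrier G"
      and inv: "\<And>x. E (\<alpha> g x) = E x" "\<And>x. \<pi> (\<alpha> g x) = \<beta> g (\<pi> x)"
      and finite: "\<bar>infimal_pushforward \<pi> E y\<bar> \<noteq> \<infinity>"
    for G :: "('g, 'm) monoid_scheme" and \<alpha> \<beta> g y
  proof -
    have "surj (\<alpha> g)" by (rule group_action.surj_prop[OF that(1,3)])
    moreover have "inj (\<beta> g)" by (rule group_action.inj_prop[OF that(2,3)])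
    ultimately have same: "infimal_pushforward \<pi> E (\<beta> g y) = infimal_pushforward \<pi> E y"
      using inv by (intro infimal_pushforward_equivariant)
    with finite have finite': "\<bar>infimal_pushforward \<pi> E (\<beta> g y)\<bar> \<noteq> \<infinity>" by simp
    have "is_arg_min E (\<lambda>x. \<pi> x = \<beta> g y) (\<alpha> g (fiber_argmin \<pi> E y))"
      using argmin[OF finite] by (simp add: is_arg_min_fiber_iff inv same)
    then have "fiber_argmin \<pi> E (\<beta> g y) = \<alpha> g (fiber_argmin \<pi> E y)"
      using unique[OF finite'] argmin[OF finite'] by (elim ex1E) metis
    with finite' show ?thesis by blast
  qed
  have attained: "E (fiber_argmin \<pi> E y) = infimal_pushforward \<pi> E y"
    if "\<bar>infimal_pushforward \<pi> E y\<bar> \<noteq> \<infinity>" for y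
    using argmin[OF that] by (simp add: is_arg_min_fiber_iff)
  show ?thesis
  proof (rule conjI)
    show "\<forall>y. \<bar>infimal_pushforward \<pi> E y\<bar> \<noteq> \<infinity> \<longrightarrow>
        (\<exists>!x. is_arg_min E (\<lambda>x. \<pi> x = y) x) \<and>
        is_arg_min E (\<lambda>x. \<pi> x = y) (fiber_argmin \<pi> E y) \<and>
        E (fiber_argmin \<pi> E y) = infimal_pushforward \<pi> E y"
      by (intro allI impI conjI unique argmin attained)
  next
    show "\<forall>(G::('g, 'm) monoid_scheme) \<alpha> \<beta>.
        group_action G UNIV \<alpha> \<and>
        (\<forall>g\<in>carrier G. \<forall>x x'. dist (\<alpha> g x) (\<alpha> g x') = dist x x') \<and>
        group_action G UNIV \<beta> \<and>
        (\<forall>g\<in>carrier G. \<forall>x. E (\<alpha> g x) = E x \<and> \<pi> (\<alpha> g x) = \<beta> g (\<pi> x)) \<longrightarrow>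
        (\<forall>g\<in>carrier G. \<forall>y. \<bar>infimal_pushforward \<pi> E y\<bar> \<noteq> \<infinity> \<longrightarrow>
           \<bar>infimal_pushforward \<pi> E (\<beta> g y)\<bar> \<noteq> \<infinity> \<and>
           fiber_argmin \<pi> E (\<beta> g y) = \<alpha> g (fiber_argmin \<pi> E y))"
    proof (intro allI impI ballI, elim conjE, rule equivariant)
    qed auto
  qed
qed

end
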